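(* Let $F\in\mathbb C[x_0,x_1,\ldots,x_b]$ be a form of degree $n\ge 3$, and let $W_F\subset\mathbb P^b$ be the set of points $p$ such that $\operatorname{rk}\mathcal H_F(p)=1$. (1) If $F$ is honest, then $W_F\cap\{F\ne 0\}$ is a finite set, and more precisely $|W_F\cap\{F\neq 0\}|\le b+1$. (2) If $F$ is non-degenerate, then $W_F$ is a finite set.
   Context: A form is a homogeneous polynomial over $\mathbb C$. A tensor of type $a_1\times\cdots\times a_m$ is a multilinear map $\mathbb C^{a_1}\times\cdots\times\mathbb C^{a_m}\to\mathbb C$, identified with its hypermatrix of values on standard basis vectors. A nonzero tensor has rank one if it equals $v_1\otimes\cdots\otimes v_m$ with nonzero $v_i\in\mathbb C^{a_i}$; the rank $\operatorname{rk}(T)$ of a nonzero tensor $T$ is the minimal $r$ such that $T$ is a sum of $r$ rank one tensors (the zero tensor has rank $0$). For a form $F\in\mathbb C[x_0,\dots,x_b]$ of degree $n\ge 3$, $\mathcal H_F$ is the hypermatrix of type $(b+1)^{\times(n-1)}$ whose $(i_1,\dots,i_{n-1})$ entry is $\partial_{i_1}\cdots\partial_{i_{n-1}}F$, with $\partial_i=\partial/\partial x_i$ and $i_j\in\{0,\dots,b\}$; its entries are linear forms in $x_0,\dots,x_b$, and $\mathcal H_F(v)$ is its evaluation at $v\in\mathbb C^{b+1}$. For $p\in\mathbb P^b$, $\operatorname{rk}\mathcal H_F(p)$ is computed using any representative of $p$ (it is independent of the choice). $F$ is honest if $\mathcal H_F(v)\neq 0$ for every nonzero $v\in\mathbb C^{b+1}$.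 $F$ is non-degenerate if $\det\mathcal H_F(v)\ne 0$ for some nonzero $v\in\mathbb C^{b+1}$, where $\det$ is the hyperdeterminant (Gelfand–Kapranov–Zelevinsky, Chapter 14) of a hypermatrix of type $(b+1)^{\times (n-1)}$. Recall that the hyperdeterminant is a polynomial in the entries (the usual determinant, up to sign, when $n=3$), which vanishes at a tensor $A$ of this type if and only if there are nonzero vectors $v_1,\dots,v_{n-1}\in\mathbb C^{b+1}$ such that for every $j$ and every $w\in\mathbb C^{b+1}$ one has $A(v_1,\dots,v_{j-1},w,v_{j+1},\dots,v_{n-1})=0$. *)

theory Defs
  imports "HOL-Analysis.Analysis" "HOL-Library.Poly_Mapping"
begin

section \<open>Multivariate polynomials and forms\<close>

text \<open>Polynomials in variables indexed by \<^typ>\<open>'v\<close>: finitely supported maps from exponent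
  vectors to coefficients, with the (convolution) ring structure of the library.\<close>

type_synonym ('v, 'a) mpoly = "('v \<Rightarrow>\<^sub>0 nat) \<Rightarrow>\<^sub>0 'a"

text \<open>Evaluation at \<^term>\<open>x\<close>, the coefficients being mapped to the target ring by \<^term>\<open>\<phi>\<close>.\<close>

definition mpoly_eval ::
  "('a::zero \<Rightarrow> 'b::comm_semiring_1) \<Rightarrow> ('v \<Rightarrow> 'b) \<Rightarrow> ('v, 'a) mpoly \<Rightarrow> 'b" where
  "mpoly_eval \<phi> x p =
     (\<Sum>t\<in>Poly_Mapping.keys p. \<phi> (Poly_Mapping.lookup p t) *
        (\<Prod>i\<in>Poly_Mapping.keys t. x i ^ Poly_Mapping.lookup t i))"

definition mpoly_vars :: "('v, 'a::zero) mpoly \<Rightarrow> 'v set" where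
  "mpoly_vars p = (\<Union>t\<in>Poly_Mapping.keys p. Poly_Mapping.keys t)"

text \<open>If \<^term>\<open>x\<^sub>i\<close> does not occur in a monomial, the truncated subtraction of exponents is
  harmless because the coefficient is then \<^term>\<open>0\<close>.\<close>

definition mpoly_deriv :: "'v \<Rightarrow> ('v, 'a::comm_semiring_1) mpoly \<Rightarrow> ('v, 'a) mpoly" where
  "mpoly_deriv i p =
     (\<Sum>t\<in>Poly_Mapping.keys p.
        Poly_Mapping.single (t - Poly_Mapping.single i 1)
          (of_nat (Poly_Mapping.lookup t i) * Poly_Mapping.lookup p t))"

definition is_form :: "nat \<Rightarrow> ('v, 'a::zero) mpoly \<Rightarrow> bool" where
  "is_form n p \<longleftrightarrow>
     (\<forall>t\<in>Poly_Mapping.keys p. (\<Sum>i\<in>Poly_Mapping.keys t. Poly_Mapping.lookup t i) = n)"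

abbreviation eval_at :: "('n::finite, complex) mpoly \<Rightarrow> complex ^ 'n \<Rightarrow> complex" where
  "eval_at F v \<equiv> mpoly_eval (\<lambda>c. c) (\<lambda>i. v $ i) F"


section \<open>Tensors\<close>

text \<open>A tensor with \<open>m\<close> slots, all of dimension \<^term>\<open>CARD('n)\<close>, is given by its hypermatrix.
  Only the entries at index lists of length \<open>m\<close> are meaningful; every notion below ignores the
  others.\<close>

type_synonym 'n hypermatrix = "'n list \<Rightarrow> complex"

definition multilinear_map ::
  "nat \<Rightarrow> ('n::finite) hypermatrix \<Rightarrow> (nat \<Rightarrow> complex ^ 'n) \<Rightarrow> complex" where
  "multilinear_map m A v = (\<Sum>is | length is = m. A is * (\<Prod>j<m. v j $ (is ! j)))"

definition zero_tensor :: "nat \<Rightarrow> 'n hypermatrix \<Rightarrow> bool" where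
  "zero_tensor m A \<longleftrightarrow> (\<forall>is. length is = m \<longrightarrow> A is = 0)"

definition rank_one :: "nat \<Rightarrow> ('n::finite) hypermatrix \<Rightarrow> bool" where
  "rank_one m A \<longleftrightarrow>
     (\<exists>v :: nat \<Rightarrow> complex ^ 'n. (\<forall>j<m. v j \<noteq> 0) \<and>
        (\<forall>is. length is = m \<longrightarrow> A is = (\<Prod>j<m. v j $ (is ! j))))"

definition tensor_rank :: "nat \<Rightarrow> ('n::finite) hypermatrix \<Rightarrow> nat" where
  "tensor_rank m A =
     (LEAST r. \<exists>T :: nat \<Rightarrow> 'n hypermatrix. (\<forall>k<r. rank_one m (T k)) \<and>
        (\<forall>is. length is = m \<longrightarrow> A is = (\<Sum>k<r. T k is)))"


section \<open>The hyperdeterminant\<close>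

definition degenerate_tensor :: "nat \<Rightarrow> ('n::finite) hypermatrix \<Rightarrow> bool" where
  "degenerate_tensor m A \<longleftrightarrow>
     (\<exists>v :: nat \<Rightarrow> complex ^ 'n. (\<forall>j<m. v j \<noteq> 0) \<and>
        (\<forall>j<m. \<forall>w. multilinear_map m A (v(j := w)) = 0))"

text \<open>Following Gelfand, Kapranov and Zelevinsky, the hyperdeterminant is the irreducible integer
  polynomial in the entries of the hypermatrix that defines the dual variety of the Segre variety.
  The dual variety consists of the degenerate tensors. For \<open>m \<ge> 2\<close> slots of equal dimension
  it is a hypersurface, so such a polynomial exists, and it is unique up to sign. The predicate
  holds exactly for these two polynomials. Their variables are the index lists of length \<open>m\<close>.\<close>

definition is_hyperdeterminant :: "nat \<Rightarrow> ('n::finite list, int) mpoly \<Rightarrow> bool" where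
  "is_hyperdeterminant m D \<longleftrightarrow>
     irreducible D \<and> mpoly_vars D \<subseteq> {is. length is = m} \<and>
     (\<forall>A. mpoly_eval of_int A D = 0 \<longleftrightarrow> degenerate_tensor m A)"


section \<open>The hypermatrix of higher derivatives\<close>

definition hess :: "('n, complex) mpoly \<Rightarrow> 'n list \<Rightarrow> ('n, complex) mpoly" where
  "hess F is = foldr mpoly_deriv is F"

definition hess_at :: "('n::finite, complex) mpoly \<Rightarrow> complex ^ 'n \<Rightarrow> 'n hypermatrix" where
  "hess_at F v is = eval_at (hess F is) v"

text \<open>In the following notions \<open>n\<close> is the degree of \<open>F\<close>, so the hypermatrix has
  \<open>n - 1\<close> slots.\<close>

definition honest :: "nat \<Rightarrow> ('n::finite, complex) mpoly \<Rightarrow> bool" where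
  "honest n F \<longleftrightarrow> (\<forall>v. v \<noteq> 0 \<longrightarrow> \<not> zero_tensor (n - 1) (hess_at F v))"

text \<open>The hyperdeterminant is unique up to sign, so the choice of \<open>D\<close> is immaterial.\<close>

definition nondegenerate :: "nat \<Rightarrow> ('n::finite, complex) mpoly \<Rightarrow> bool" where
  "nondegenerate n F \<longleftrightarrow>
     (\<exists>D. is_hyperdeterminant (n - 1) D \<and>
        (\<exists>v. v \<noteq> 0 \<and> mpoly_eval of_int (hess_at F v) D \<noteq> 0))"


section \<open>Projective space\<close>

text \<open>Points are complex lines through the origin (\<^term>\<open>vec.span\<close> is the span over the complex
  scalars). The conditions on points below are invariant under nonzero rescaling of the
  representative when \<open>F\<close> is a form of degree \<open>n\<close>.\<close>

definition proj_space :: "(complex ^ 'n::finite) set set" where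
  "proj_space = {vec.span {v} | v. v \<noteq> 0}"

definition W :: "nat \<Rightarrow> ('n::finite, complex) mpoly \<Rightarrow> (complex ^ 'n) set set" where
  "W n F = {p \<in> proj_space. \<exists>v\<in>p. v \<noteq> 0 \<and> tensor_rank (n - 1) (hess_at F v) = 1}"

definition nonvanishing :: "('n::finite, complex) mpoly \<Rightarrow> (complex ^ 'n) set set" where
  "nonvanishing F = {p \<in> proj_space. \<exists>v\<in>p. v \<noteq> 0 \<and> eval_at F v \<noteq> 0}"

end

theory Submission imports Defs begin

text \<open>Write \<open>T\<close> for the symmetric \<open>n\<close>-linear form that polarizes \<open>F\<close>, up to a constant factor, so
  that the hypermatrix at \<open>p\<close> is \<open>T(p, \<cdot>, \<dots>, \<cdot>)\<close>. A point \<open>p\<close> lies in \<open>W\<close> iff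
  \<open>T(p, \<cdot>, \<dots>, \<cdot>) = c\<^sub>p l\<^sub>p\<^bsup>n-1\<^esup>\<close> for a nonzero linear form \<open>l\<^sub>p\<close>.

  If \<open>F\<close> is honest, \<open>p \<mapsto> T(p, \<cdot>, \<dots>, \<cdot>)\<close> is injective, so distinct points of \<open>W\<close> have
  non-proportional \<open>l\<^sub>p\<close>, \<open>l\<^sub>q\<close>; comparing the two expressions for \<open>T(p, q, \<cdot>, \<dots>, \<cdot>)\<close> gives
  \<open>l\<^sub>p(q) = 0\<close>. As \<open>F(p) \<noteq> 0\<close> forces \<open>l\<^sub>p(p) \<noteq> 0\<close>, the points of \<open>W\<close> with \<open>F \<noteq> 0\<close> are linearly
  independent.

  If \<open>T(v, \<cdot>, \<dots>, \<cdot>)\<close> is non-degenerate, then \<open>x \<mapsto> T(x, v, \<cdot>, \<dots>, \<cdot>)\<close> is injective, hence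
  \<open>l\<^sub>p(v) \<noteq> 0\<close> and \<open>T(p, y, \<cdot>, \<dots>, \<cdot>) = (l\<^sub>p(y) / l\<^sub>p(v)) T(p, v, \<cdot>, \<dots>, \<cdot>)\<close> for \<open>p\<close> in \<open>W\<close>. So the
  points of \<open>W\<close> are common eigenvectors with pairwise distinct eigenvalue functions, and all of
  \<open>W\<close> is linearly independent.\<close>

section \<open>Derivatives of forms\<close>

text \<open>The coefficientwise form removes the truncated subtraction: a monomial \<open>s\<close>
  without the variable \<open>i\<close> may satisfy \<open>s - ?e = t\<close>, but it carries the
  coefficient 0.\<close>

lemma mpoly_deriv_lookup:
  "Poly_Mapping.lookup (mpoly_deriv i p) t =
     of_nat (Suc (Poly_Mapping.lookup t i)) * Poly_Mapping.lookup p (t + Poly_Mapping.single i 1)"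
proof -
  let ?e = "Poly_Mapping.single i (1::nat)"
  let ?c = "\<lambda>s. of_nat (Poly_Mapping.lookup s i) * Poly_Mapping.lookup p s"
  have "(?c s when s - ?e = t) = (if s = t + ?e then ?c s else 0)" for s
  proof (cases "Poly_Mapping.lookup s i = 0")
    case True
    then have "s \<noteq> t + ?e" by (auto simp: lookup_add)
    with True show ?thesis by (simp add: when_def)
  next
    case False
    then have "s - ?e + ?e = s"
      by (intro poly_mapping_eqI) (auto simp: lookup_add lookup_minus lookup_single when_def)
    then have "s - ?e = t \<longleftrightarrow> s = t + ?e" by auto
    then show ?thesis by (simp add: when_def)
  qed
  then have "Poly_Mapping.lookup (mpoly_deriv i p) t =
      (\<Sum>s\<in>Poly_Mapping.keys p. if s = t + ?e then ?c s else 0)"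
    by (simp add: mpoly_deriv_def lookup_sum lookup_single)
  also have "\<dots> = ?c (t + ?e)"
    by (simp add: in_keys_iff)
  finally show ?thesis by (simp add: lookup_add)
qed

lemma mpoly_deriv_commute: "mpoly_deriv i (mpoly_deriv j p) = mpoly_deriv j (mpoly_deriv i p)"
  by (intro poly_mapping_eqI)
    (auto simp: mpoly_deriv_lookup lookup_add lookup_single when_def ac_simps)

lemma hess_perm: "mset is = mset js \<Longrightarrow> hess F is = hess F js"
  unfolding hess_def foldr_conv_fold
  by (intro fold_permuted_eq[where P = "\<lambda>_. True"]) (auto simp: mpoly_deriv_commute)

lemma degree_eq_sum_UNIV:
  fixes t :: "'v::finite \<Rightarrow>\<^sub>0 nat"
  shows "(\<Sum>i\<in>Poly_Mapping.keys t. Poly_Mapping.lookup t i) = (\<Sum>i\<in>UNIV. Poly_Mapping.lookup t i)"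
  by (rule sum.mono_neutral_left) (auto simp: in_keys_iff)

lemma is_form_mpoly_deriv:
  fixes p :: "('v::finite, 'a::comm_semiring_1) mpoly"
  assumes "is_form (Suc d) p"
  shows "is_form d (mpoly_deriv i p)"
  unfolding is_form_def
proof
  fix t assume "t \<in> Poly_Mapping.keys (mpoly_deriv i p)"
  then have "t + Poly_Mapping.single i 1 \<in> Poly_Mapping.keys p"
    by (auto simp: in_keys_iff mpoly_deriv_lookup)
  then have "(\<Sum>j\<in>UNIV. Poly_Mapping.lookup (t + Poly_Mapping.single i 1) j) = Suc d"
    using assms by (simp add: is_form_def degree_eq_sum_UNIV)
  then show "(\<Sum>j\<in>Poly_Mapping.keys t. Poly_Mapping.lookup t j) = d"
    by (simp add: degree_eq_sum_UNIV lookup_add lookup_single when_def sum.distrib)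
qed

lemma is_form_hess:
  fixes F :: "('n::finite, complex) mpoly"
  assumes "is_form (length is + d) F"
  shows "is_form d (hess F is)"
  using assms
  by (induction "is" arbitrary: d) (auto simp: hess_def intro!: is_form_mpoly_deriv)

section \<open>Evaluation and Euler's identity\<close>

definition monom_eval :: "('v \<Rightarrow> 'a::comm_semiring_1) \<Rightarrow> ('v \<Rightarrow>\<^sub>0 nat) \<Rightarrow> 'a" where
  "monom_eval x t = (\<Prod>i\<in>Poly_Mapping.keys t. x i ^ Poly_Mapping.lookup t i)"

lemma monom_eval_add_single:
  fixes x :: "'v::finite \<Rightarrow> 'a::comm_semiring_1"
  shows "monom_eval x (t + Poly_Mapping.single i 1) = x i * monom_eval x t"
proof -
  have UNIV: "monom_eval x s = (\<Prod>i\<in>UNIV. x i ^ Poly_Mapping.lookup s i)" for s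
    unfolding monom_eval_def by (rule prod.mono_neutral_left) (auto simp: in_keys_iff)
  have "(\<Prod>j\<in>UNIV. x j ^ Poly_Mapping.lookup (Poly_Mapping.single i 1) j) = (\<Prod>j\<in>UNIV. if i = j then x j else 1)"
    by (rule prod.cong) (auto simp: lookup_single when_def)
  then show ?thesis
    by (simp add: UNIV lookup_add power_add prod.distrib mult.commute)
qed

lemma mpoly_eval_superset:
  assumes "finite S" "Poly_Mapping.keys p \<subseteq> S"
  shows "mpoly_eval (\<lambda>c. c) x p = (\<Sum>t\<in>S. Poly_Mapping.lookup p t * monom_eval x t)"
  unfolding mpoly_eval_def monom_eval_def
  using assms by (intro sum.mono_neutral_left) (auto simp: in_keys_iff)

lemma mpoly_eval_add:
  "mpoly_eval (\<lambda>c. c) x (p + q) = mpoly_eval (\<lambda>c. c) x p + mpoly_eval (\<lambda>c. c) x q"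
proof -
  let ?S = "Poly_Mapping.keys p \<union> Poly_Mapping.keys q"
  have "Poly_Mapping.keys (p + q) \<subseteq> ?S" by (rule Poly_Mapping.keys_add)
  then show ?thesis
    by (simp add: mpoly_eval_superset[of ?S] lookup_add distrib_right sum.distrib)
qed

lemma mpoly_eval_sum:
  "mpoly_eval (\<lambda>c. c) x (\<Sum>a\<in>A. f a) = (\<Sum>a\<in>A. mpoly_eval (\<lambda>c. c) x (f a))"
proof (induction A rule: infinite_finite_induct)
  case (insert a A)
  then show ?case by (simp add: mpoly_eval_add)
qed (simp_all add: mpoly_eval_def)

lemma mpoly_eval_single: "mpoly_eval (\<lambda>c. c) x (Poly_Mapping.single t c) = c * monom_eval x t"
  by (subst mpoly_eval_superset[of "{t}"]) auto

text \<open>Multiplying the \<open>i\<close>-th derivative of a monomial by \<open>x i\<close>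
  restores the monomial with its exponent of \<open>i\<close> as a factor, and these exponents sum
  to \<open>d\<close>.\<close>

lemma mpoly_eval_euler:
  fixes G :: "('v::finite, 'a::comm_semiring_1) mpoly"
  assumes "is_form d G"
  shows "(\<Sum>i\<in>UNIV. x i * mpoly_eval (\<lambda>c. c) x (mpoly_deriv i G)) = of_nat d * mpoly_eval (\<lambda>c. c) x G"
proof -
  have "x i * (of_nat (Poly_Mapping.lookup t i) * Poly_Mapping.lookup G t * monom_eval x (t - Poly_Mapping.single i 1))
      = of_nat (Poly_Mapping.lookup t i) * (Poly_Mapping.lookup G t * monom_eval x t)" for i t
  proof (cases "Poly_Mapping.lookup t i = 0")
    case False
    then have "t = t - Poly_Mapping.single i 1 + Poly_Mapping.single i 1"
      by (intro poly_mapping_eqI) (auto simp: lookup_add lookup_minus lookup_single when_def)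
    then have "monom_eval x t = x i * monom_eval x (t - Poly_Mapping.single i 1)"
      by (metis monom_eval_add_single)
    then show ?thesis by (simp add: ac_simps)
  qed simp
  then have "(\<Sum>i\<in>UNIV. x i * mpoly_eval (\<lambda>c. c) x (mpoly_deriv i G)) =
      (\<Sum>i\<in>UNIV. \<Sum>t\<in>Poly_Mapping.keys G. of_nat (Poly_Mapping.lookup t i) * (Poly_Mapping.lookup G t * monom_eval x t))"
    by (simp add: mpoly_deriv_def mpoly_eval_sum mpoly_eval_single sum_distrib_left)
  also have "\<dots> = (\<Sum>t\<in>Poly_Mapping.keys G. of_nat d * (Poly_Mapping.lookup G t * monom_eval x t))"
  proof (subst sum.swap, rule sum.cong)
    fix t assume "t \<in> Poly_Mapping.keys G"
    then have "(\<Sum>i\<in>UNIV. Poly_Mapping.lookup t i) = d"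
      using assms by (simp add: is_form_def degree_eq_sum_UNIV)
    then show "(\<Sum>i\<in>UNIV. of_nat (Poly_Mapping.lookup t i) * (Poly_Mapping.lookup G t * monom_eval x t))
        = of_nat d * (Poly_Mapping.lookup G t * monom_eval x t)"
      by (simp flip: sum_distrib_right of_nat_sum)
  qed simp
  finally show ?thesis
    by (simp add: mpoly_eval_superset[of "Poly_Mapping.keys G" G] sum_distrib_left)
qed

lemma mpoly_eval_form_0:
  fixes p :: "('v::finite, 'a::comm_semiring_1) mpoly"
  assumes "is_form 0 p"
  shows "mpoly_eval (\<lambda>c. c) x p = mpoly_eval (\<lambda>c. c) y p"
proof -
  have keys: "Poly_Mapping.keys t = {}" if "t \<in> Poly_Mapping.keys p" for t
    using assms that by (fastforce simp: is_form_def in_keys_iff simp del: keys_eq_empty)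
  show ?thesis
    unfolding mpoly_eval_def by (rule sum.cong[OF refl], subst (1 2) keys) auto
qed

text \<open>Here \<open>hess F is\<close> is a linear form, so Euler's identity in degree 1 expands
  it through its derivatives. These are constants, so the evaluation point 0 is arbitrary.\<close>

lemma hess_at_linear_expansion:
  fixes F :: "('n::finite, complex) mpoly"
  assumes "is_form (Suc (length is)) F"
  shows "hess_at F x is = (\<Sum>j\<in>UNIV. x $ j * hess_at F 0 (j # is))"
proof -
  have form: "is_form 1 (hess F is)" using assms by (intro is_form_hess) simp
  have "hess_at F x is = (\<Sum>j\<in>UNIV. x $ j * eval_at (mpoly_deriv j (hess F is)) x)"
    using mpoly_eval_euler[OF form, of "\<lambda>i. x $ i"] by (simp add: hess_at_def)
  also have "\<dots> = (\<Sum>j\<in>UNIV. x $ j * hess_at F 0 (j # is))"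
    using is_form_mpoly_deriv[of 0 "hess F is"] form
    by (intro sum.cong) (auto simp: hess_at_def hess_def intro!: mpoly_eval_form_0)
  finally show ?thesis .
qed

section \<open>Tensor rank one and contractions\<close>

lemma finite_lists_of_length: "finite {xs :: 'n::finite list. length xs = m}"
  using finite_lists_length_eq[of "UNIV :: 'n set" m] by simp

text \<open>Needed because \<^const>\<open>tensor_rank\<close> is a \<^const>\<open>Least\<close>, which is
  unspecified on an empty predicate.\<close>

lemma rank_one_decomposition_exists:
  fixes A :: "'n::finite hypermatrix"
  assumes "m > 0"
  shows "\<exists>(r::nat) T. (\<forall>k<r. rank_one m (T k)) \<and> (\<forall>is. length is = m \<longrightarrow> A is = (\<Sum>k<r. T k is))"
proof -
  let ?S = "{is. length is = m \<and> A is \<noteq> 0}"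
  define E where "E = (\<lambda>js is :: 'n list. if is = js then A js else 0)"
  have fin: "finite ?S" by (rule finite_subset[OF _ finite_lists_of_length[of m]]) auto
  then obtain h where "bij_betw h {0..<card ?S} ?S"
    using ex_bij_betw_nat_finite by blast
  then have h: "bij_betw h {..<card ?S} ?S" by (simp add: atLeast0LessThan)
  have "rank_one m (E js)" if js: "js \<in> ?S" for js
    unfolding rank_one_def
  proof (intro exI conjI allI impI)
    \<comment> \<open>The coefficient goes into slot 0, which exists because \<open>m > 0\<close>;
      it is nonzero on \<open>?S\<close>, so all factors are nonzero vectors.\<close>
    let ?v = "\<lambda>j. (if j = 0 then A js else 1) *s (axis (js ! j) 1 :: complex ^ 'n)"
    show "?v j \<noteq> 0" for j using js by (simp add: axis_eq_0_iff)
    fix ks :: "'n list" assume ks: "length ks = m"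
    show "E js ks = (\<Prod>j<m. ?v j $ (ks ! j))"
    proof (cases "ks = js")
      case True
      then show ?thesis
        using assms by (simp add: E_def axis_def)
    next
      case False
      then obtain j where "j < m" "ks ! j \<noteq> js ! j"
        using js ks by (auto simp: list_eq_iff_nth_eq)
      then have "(\<Prod>j<m. ?v j $ (ks ! j)) = 0"
        by (intro prod_zero bexI[of _ j]) (auto simp: axis_def)
      then show ?thesis using False by (simp add: E_def)
    qed
  qed
  moreover have "A ks = (\<Sum>k<card ?S. E (h k) ks)" if "length ks = m" for ks
  proof -
    have "(\<Sum>k<card ?S. E (h k) ks) = (\<Sum>js\<in>?S. E js ks)"
      by (rule sum.reindex_bij_betw[OF h])
    also have "\<dots> = A ks" using that fin by (simp add: E_def)
    finally show ?thesis by simp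
  qed
  ultimately show ?thesis
    using bij_betwE[OF h] by (intro exI[of _ "card ?S"] exI[of _ "\<lambda>k. E (h k)"]) auto
qed

lemma tensor_rank_1_imp_rank_one:
  fixes A :: "'n::finite hypermatrix"
  assumes "m > 0" "tensor_rank m A = 1"
  shows "rank_one m A"
proof -
  let ?P = "\<lambda>r::nat. \<exists>T :: nat \<Rightarrow> 'n hypermatrix. (\<forall>k<r. rank_one m (T k)) \<and>
        (\<forall>is. length is = m \<longrightarrow> A is = (\<Sum>k<r. T k is))"
  have "?P (LEAST r. ?P r)"
    using rank_one_decomposition_exists[OF assms(1), of A] by (rule LeastI_ex)
  then have "?P 1" using assms(2) unfolding tensor_rank_def by simp
  then show ?thesis by (auto simp: rank_one_def)
qed


lemma hess_at_euler:
  fixes F :: "('n::finite, complex) mpoly"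
  assumes "is_form (length is + d) F"
  shows "(\<Sum>i\<in>UNIV. v $ i * hess_at F v (i # is)) = of_nat d * hess_at F v is"
  using mpoly_eval_euler[OF is_form_hess[OF assms], of "\<lambda>i. v $ i"] by (simp add: hess_at_def hess_def)

text \<open>Euler's identity expresses \<open>n - k\<close> times a derivative of order
  \<open>k\<close> through those of order \<open>k + 1\<close>, so vanishing descends to order 0,
  which is \<open>F\<close> itself.\<close>

lemma eval_at_eq_0_if_hess_at_eq_0:
  fixes F :: "('n::finite, complex) mpoly"
  assumes "is_form n F" "k < n" "\<And>is. length is = k \<Longrightarrow> hess_at F v is = 0"
  shows "eval_at F v = 0"
  using assms(2,3)
proof (induction k)
  case 0
  then show ?case by (simp add: hess_at_def hess_def)
next
  case (Suc k)
  have "hess_at F v is = 0" if "length is = k" for "is"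
  proof -
    have "of_nat (n - k) * hess_at F v is = 0"
      using hess_at_euler[of "is" "n - k" F v] that assms(1) Suc.prems by simp
    then show ?thesis using Suc.prems(1) by simp
  qed
  then show ?case using Suc by simp
qed

section \<open>Symmetric hypermatrices, contractions and powers of linear forms\<close>

definition symmetric_hypermatrix :: "'n hypermatrix \<Rightarrow> bool" where
  "symmetric_hypermatrix A \<longleftrightarrow> (\<forall>is js. mset is = mset js \<longrightarrow> A is = A js)"

definition contract :: "('n::finite) hypermatrix \<Rightarrow> complex ^ 'n \<Rightarrow> 'n hypermatrix" where
  "contract A x is = (\<Sum>i\<in>UNIV. x $ i * A (i # is))"

definition pairing :: "complex ^ 'n::finite \<Rightarrow> complex ^ 'n \<Rightarrow> complex" where
  "pairing l x = (\<Sum>i\<in>UNIV. l $ i * x $ i)"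

text \<open>Keeping the scalar \<open>c\<close> apart from \<open>l\<close> avoids extracting
  roots.\<close>

definition power_form :: "nat \<Rightarrow> ('n::finite) hypermatrix \<Rightarrow> complex \<Rightarrow> complex ^ 'n \<Rightarrow> bool" where
  "power_form m A c l \<longleftrightarrow> c \<noteq> 0 \<and> l \<noteq> 0 \<and> (\<forall>is. length is = m \<longrightarrow> A is = c * (\<Prod>i\<leftarrow>is. l $ i))"

lemma symmetric_hypermatrixD: "symmetric_hypermatrix A \<Longrightarrow> mset is = mset js \<Longrightarrow> A is = A js"
  unfolding symmetric_hypermatrix_def by blast

lemma symmetric_hess_at: "symmetric_hypermatrix (hess_at F v)"
  unfolding symmetric_hypermatrix_def hess_at_def
  by (intro allI impI arg_cong[where f = "\<lambda>G. eval_at G v"] hess_perm)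

lemma symmetric_contract: "symmetric_hypermatrix A \<Longrightarrow> symmetric_hypermatrix (contract A x)"
  unfolding symmetric_hypermatrix_def contract_def
  by (intro allI impI sum.cong refl arg_cong[where f = "(*) _"]) simp

lemma contract_commute:
  assumes "symmetric_hypermatrix A"
  shows "contract (contract A x) y is = contract (contract A y) x is"
proof -
  have "A (i # j # is) = A (j # i # is)" for i j
    by (rule symmetric_hypermatrixD[OF assms]) simp
  then show ?thesis
    unfolding contract_def sum_distrib_left
    by (subst sum.swap) (simp add: ac_simps)
qed

lemma contract_scale: "contract A (a *s x) is = a * contract A x is"
  by (simp add: contract_def sum_distrib_left ac_simps)

lemma contract_diff: "contract A (x - y) is = contract A x is - contract A y is"
  by (simp add: contract_def sum_subtractf left_diff_distrib)

lemma contract_sum: "contract A (\<Sum>a\<in>S. f a) is = (\<Sum>a\<in>S. contract A (f a) is)"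
  by (simp add: contract_def sum_distrib_right) (rule sum.swap)

lemma contract_contract_scale: "contract (contract A (a *s x)) y is = a * contract (contract A x) y is"
  unfolding contract_def[of "contract A _"] by (simp add: contract_scale sum_distrib_left ac_simps)

lemma contract_contract_sum:
  "contract (contract A (\<Sum>a\<in>S. f a)) y is = (\<Sum>a\<in>S. contract (contract A (f a)) y is)"
  unfolding contract_def[of "contract A _"] contract_sum sum_distrib_left by (rule sum.swap)

lemma pairing_axis: "pairing l (axis i 1) = l $ i"
  by (simp add: pairing_def axis_def if_distrib[of "(*) _"] cong: if_cong)

lemma pairing_scale: "pairing l (a *s x) = a * pairing l x"
  by (simp add: pairing_def sum_distrib_left ac_simps)

lemma pairing_add: "pairing l (x + y) = pairing l x + pairing l y"
  by (simp add: pairing_def distrib_left sum.distrib)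

lemma contract_power_form:
  assumes "power_form (Suc m) A c l" "length is = m"
  shows "contract A x is = c * pairing l x * (\<Prod>i\<leftarrow>is. l $ i)"
  using assms
  by (simp add: contract_def power_form_def pairing_def sum_distrib_left sum_distrib_right ac_simps)

lemma power_form_contract_scale:
  assumes "power_form m (contract A x) c l" "a \<noteq> 0"
  shows "power_form m (contract A (a *s x)) (a * c) l"
  using assms by (simp add: power_form_def contract_scale)

text \<open>Symmetry lets every index pass through the first slot, where the entry depends on it
  only via \<open>v 0\<close>. So \<open>v 0\<close> alone determines the tensor up to a
  scalar.\<close>

lemma rank_one_imp_power_form:
  fixes A :: "'n::finite hypermatrix"
  assumes sym: "symmetric_hypermatrix A" and "rank_one (Suc m) A"
  shows "\<exists>c l. power_form (Suc m) A c l"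
proof -
  obtain v :: "nat \<Rightarrow> complex ^ 'n" where nz: "\<forall>j<Suc m. v j \<noteq> 0"
    and A: "\<And>is. length is = Suc m \<Longrightarrow> A is = (\<Prod>j<Suc m. v j $ (is ! j))"
    using assms(2) by (auto simp: rank_one_def)
  have "\<forall>j. \<exists>i. j < Suc m \<longrightarrow> v j $ i \<noteq> 0"
    using nz by (metis vec_eq_iff zero_index)
  then obtain f where f: "\<And>j. j < Suc m \<Longrightarrow> v j $ f j \<noteq> 0" by metis
  define l where "l = v 0"
  define a where "a = f 0"
  have a: "l $ a \<noteq> 0" using f by (simp add: l_def a_def)
  have swap: "l $ a * A (i # js) = l $ i * A (a # js)" if "length js = m" for i js
    using that by (simp add: A prod.lessThan_Suc_shift l_def del: prod.lessThan_Suc)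
  \<comment> \<open>Each index of \<open>us\<close> is exchanged for the reference index
    \<open>a\<close> in the first slot and then moved behind the remaining ones, into
    \<open>ws\<close>.\<close>
  have replace: "(l $ a) ^ length us * A (us @ ws) = (\<Prod>i\<leftarrow>us. l $ i) * A (replicate (length us) a @ ws)"
    if "length us + length ws = Suc m" for us ws
    using that
  proof (induction us arbitrary: ws)
    case (Cons u us)
    have "(l $ a) ^ length (u # us) * A ((u # us) @ ws)
        = (l $ a) ^ length us * (l $ a * A (u # (us @ ws)))"
      by simp
    also have "\<dots> = l $ u * ((l $ a) ^ length us * A (us @ (a # ws)))"
      using Cons.prems symmetric_hypermatrixD[OF sym, of "a # us @ ws" "us @ a # ws"]
      by (subst swap) auto
    also have "\<dots> = l $ u * ((\<Prod>i\<leftarrow>us. l $ i) * A (replicate (length us) a @ a # ws))"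
      using Cons.prems by (subst Cons.IH) auto
    also have "A (replicate (length us) a @ a # ws) = A (replicate (length (u # us)) a @ ws)"
      by (rule symmetric_hypermatrixD[OF sym]) simp
    finally show ?case by simp
  qed simp
  define c where "c = A (replicate (Suc m) a) / (l $ a) ^ Suc m"
  have power: "A is = c * (\<Prod>i\<leftarrow>is. l $ i)" if "length is = Suc m" for "is"
    using replace[of "is" "[]"] that a by (simp add: c_def field_simps)
  \<comment> \<open>An entry all of whose factors are nonzero shows that \<open>A\<close>, and hence
    \<open>c\<close>, does not vanish.\<close>
  have "A (map f [0..<Suc m]) \<noteq> 0"
    using f by (subst A) (auto simp del: upt_Suc)
  then have "c \<noteq> 0" using power[of "map f [0..<Suc m]"] by auto
  moreover have "l \<noteq> 0" using a by auto
  ultimately show ?thesis using power unfolding power_form_def by blast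
qed

lemma prod_list_scale:
  fixes l :: "complex ^ 'n::finite"
  shows "(\<Prod>i\<leftarrow>is. (s *s l) $ i) = s ^ length is * (\<Prod>i\<leftarrow>is. l $ i)"
  by (induction "is") (simp_all add: mult_ac)

lemma proportional_if_power_forms_proportional:
  assumes p: "power_form m (contract t p) c l" and q: "power_form m (contract t q) d (s *s l)"
    and inj: "\<And>x. (\<And>is. length is = m \<Longrightarrow> contract t x is = 0) \<Longrightarrow> x = 0"
  shows "\<exists>r. q = r *s p"
proof -
  \<comment> \<open>The factor comes from d (s l)^m = (d s^m / c) c l^m: both points then have the
    same contraction.\<close>
  have "q - (d * s ^ m / c) *s p = 0"
  proof (rule inj)
    fix "is" :: "'a list" assume "length is = m"
    then show "contract t (q - (d * s ^ m / c) *s p) is = 0"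
      using p q by (simp add: power_form_def contract_diff contract_scale prod_list_scale
          del: vector_smult_component)
  qed
  then show ?thesis by auto
qed

text \<open>Contracting with \<open>p\<close> and \<open>q\<close> in either order gives c l(q)
  l^(k+1) = d l'(p) l'^(k+1). The left side is nonzero; fixing \<open>k\<close> of the remaining
  slots at an index where \<open>l\<close> is nonzero leaves proportional linear forms.\<close>

lemma proportional_if_pairing_nonzero:
  fixes p q :: "complex ^ 'n::finite"
  assumes sym: "symmetric_hypermatrix t"
    and p: "power_form (Suc (Suc k)) (contract t p) c l"
    and q: "power_form (Suc (Suc k)) (contract t q) d l'"
    and nz: "pairing l q \<noteq> 0"
  shows "\<exists>s. l' = s *s l"
proof -
  have eq: "c * pairing l q * (\<Prod>i\<leftarrow>is. l $ i) = d * pairing l' p * (\<Prod>i\<leftarrow>is. l' $ i)"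
    if "length is = Suc k" for "is"
    using contract_commute[OF sym, of p q "is"] contract_power_form[OF p that]
      contract_power_form[OF q that] by simp
  have nz': "c \<noteq> 0" "l \<noteq> 0" "d \<noteq> 0" using p q by (auto simp: power_form_def)
  then obtain a where a: "l $ a \<noteq> 0" by (auto simp: vec_eq_iff)
  let ?R = "replicate k a"
  have "d * pairing l' p * (\<Prod>i\<leftarrow>a # ?R. l' $ i) \<noteq> 0"
    by (subst eq[symmetric]) (use nz nz' a in auto)
  then have nz'': "d * pairing l' p * (\<Prod>i\<leftarrow>?R. l' $ i) \<noteq> 0" by auto
  have "d * pairing l' p * (\<Prod>i\<leftarrow>?R. l' $ i) * l' $ i = c * pairing l q * (\<Prod>i\<leftarrow>?R. l $ i) * l $ i" for i
    using eq[of "i # ?R"] by (simp add: ac_simps)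
  then have "l' = (c * pairing l q * (\<Prod>i\<leftarrow>?R. l $ i) / (d * pairing l' p * (\<Prod>i\<leftarrow>?R. l' $ i))) *s l"
    using nz'' by (simp add: vec_eq_iff field_simps)
  then show ?thesis by blast
qed

section \<open>Linear independence of points\<close>

lemma card_le_if_independent_representatives:
  fixes S :: "(complex ^ 'n::finite) set set"
  assumes "\<And>p. p \<in> S \<Longrightarrow> vec.span {g p} = p" "vec.independent (g ` S)"
  shows "finite S \<and> card S \<le> CARD('n)"
proof -
  have "inj_on g S" using assms(1) by (metis inj_onI)
  moreover have "finite (g ` S) \<and> card (g ` S) \<le> CARD('n)"
    using vec.independent_bound_general[OF assms(2)] vec.dim_subset_UNIV[of "g ` S"]
    by (auto simp: vec.dimension_def card_cart_basis)
  ultimately show ?thesis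
    by (simp add: card_image finite_image_iff)
qed

text \<open>The functional of \<open>x\<close> kills the span of the other vectors but not
  \<open>x\<close>.\<close>

lemma independent_if_dual_family:
  assumes "\<And>x. x \<in> B \<Longrightarrow> pairing (f x) x \<noteq> 0"
    and "\<And>x y. x \<in> B \<Longrightarrow> y \<in> B \<Longrightarrow> x \<noteq> y \<Longrightarrow> pairing (f x) y = 0"
  shows "vec.independent B"
proof
  assume "vec.dependent B"
  then obtain x where x: "x \<in> B" "x \<in> vec.span (B - {x})"
    by (auto simp: vec.dependent_def)
  have "pairing (f x) w = 0" if "w \<in> vec.span (B - {x})" for w
    using that
  proof (induction rule: vec.span_induct_alt)
    case base
    then show ?case by (simp add: pairing_def)
  next
    case (step a y z)
    then have "pairing (f x) y = 0" using assms(2) x(1) by auto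
    then show ?case using step by (simp add: pairing_add pairing_scale)
  qed
  then have "pairing (f x) x = 0" using x(2) by blast
  then show False using assms(1) x(1) by blast
qed

text \<open>The points of \<open>B\<close> behave like common eigenvectors of the maps \<open>t(\<cdot>, y)\<close> relative to the
  injective map \<open>t(\<cdot>, v)\<close>, with the functions \<open>h x\<close> as pairwise distinct families of eigenvalues.\<close>

lemma independent_if_eigenvectors:
  assumes nz: "0 \<notin> B"
    and inj: "\<And>x. (\<And>is. length is = m \<Longrightarrow> contract (contract t x) v is = 0) \<Longrightarrow> x = 0"
    and eig: "\<And>x y is. x \<in> B \<Longrightarrow> length is = m \<Longrightarrow>
        contract (contract t x) y is = h x y * contract (contract t x) v is"
    and h: "inj_on h B"
  shows "vec.independent B"
proof -
  have "vec.independent A" if "finite A" "A \<subseteq> B" for A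
    using that
  proof (induction A rule: finite_induct)
    case (insert p A)
    have ind: "vec.independent A" using insert by blast
    then have indD: "\<forall>v\<in>A. c v = 0" if "(\<Sum>v\<in>A. c v *s v) = 0" for c
      using that by (simp add: vec.independent_explicit)
    have "p \<notin> vec.span A"
    proof
      assume "p \<in> vec.span A"
      then obtain u where u: "p = (\<Sum>q\<in>A. u q *s q)"
        using insert.hyps(1) by (auto simp: vec.span_finite)
      have "u q = 0" if q: "q \<in> A" for q
      proof (rule ccontr)
        assume "u q \<noteq> 0"
        have "h q y = h p y" for y
        proof -
          \<comment> \<open>Expanding \<open>p\<close> in its eigenvalue equation and subtracting
            \<open>h p y\<close> times the expansion of t(p, v) gives a relation among the vectors
            of \<open>A\<close> alone.\<close>
          have "(\<Sum>r\<in>A. (u r * (h r y - h p y)) *s r) = 0"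
          proof (rule inj)
            fix "is" :: "'a list" assume len: "length is = m"
            let ?K = "\<lambda>r. contract (contract t r) v is"
            have "(\<Sum>r\<in>A. u r * (h r y * ?K r)) = contract (contract t p) y is"
              using insert.prems len
              by (subst u) (auto simp: contract_contract_sum contract_contract_scale eig[of _ "is" y] intro!: sum.cong)
            also have "\<dots> = h p y * ?K p"
              using insert.prems len by (simp add: eig[of _ "is" y])
            also have "?K p = (\<Sum>r\<in>A. u r * ?K r)"
              by (subst u) (simp add: contract_contract_sum contract_contract_scale)
            finally have "(\<Sum>r\<in>A. u r * (h r y * ?K r)) = h p y * (\<Sum>r\<in>A. u r * ?K r)" .
            then show "contract (contract t (\<Sum>r\<in>A. (u r * (h r y - h p y)) *s r)) v is = 0"
              unfolding contract_contract_sum contract_contract_scale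
              by (simp add: algebra_simps sum_subtractf sum_distrib_left)
          qed
          then have "u q * (h q y - h p y) = 0"
            using indD[of "\<lambda>r. u r * (h r y - h p y)"] q by blast
          then show ?thesis using \<open>u q \<noteq> 0\<close> by simp
        qed
        then have "h q = h p" by (rule ext)
        then have "q = p"
          using h q insert.prems by (auto dest: inj_onD)
        then show False using q insert.hyps(2) by simp
      qed
      then have "p = 0" by (subst u) simp
      then show False using nz insert.prems by auto
    qed
    then show ?case using ind by (rule vec.independent_insertI)
  qed (simp add: vec.independent_empty)
  then show ?thesis
    unfolding vec.independent_explicit_finite_subsets by blast
qed

section \<open>Degenerate tensors\<close>

lemma multilinear_map_Suc:
  "multilinear_map (Suc m) A v = multilinear_map m (contract A (v 0)) (\<lambda>j. v (Suc j))"
proof -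
  let ?f = "\<lambda>(is, i). i # is :: 'a list"
  have lists: "{is. length is = Suc m} = ?f ` ({is. length is = m} \<times> UNIV)"
    by (force simp: length_Suc_conv image_iff)
  have inj: "inj_on ?f ({is. length is = m} \<times> UNIV)"
    by (auto intro!: inj_onI)
  have "multilinear_map (Suc m) A v =
      (\<Sum>(is, i)\<in>{is. length is = m} \<times> UNIV. A (i # is) * (v 0 $ i * (\<Prod>j<m. v (Suc j) $ (is ! j))))"
    unfolding multilinear_map_def lists sum.reindex[OF inj]
    by (simp add: case_prod_unfold prod.lessThan_Suc_shift del: prod.lessThan_Suc)
  also have "\<dots> = (\<Sum>is | length is = m. \<Sum>i\<in>UNIV. A (i # is) * (v 0 $ i * (\<Prod>j<m. v (Suc j) $ (is ! j))))"
    by (rule sum.cartesian_product[symmetric])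
  also have "\<dots> = multilinear_map m (contract A (v 0)) (\<lambda>j. v (Suc j))"
    by (simp add: multilinear_map_def contract_def sum_distrib_left sum_distrib_right ac_simps)
  finally show ?thesis .
qed

text \<open>With \<open>x\<close> in every slot, changing one argument leaves \<open>x\<close> in
  another, since there are at least two slots. If slot 0 is the changed one, symmetry brings an
  \<open>x\<close> to the front.\<close>

lemma degenerate_tensor_if_contract_eq_0:
  assumes sym: "symmetric_hypermatrix A" and "x \<noteq> 0"
    and 0: "\<And>is. length is = Suc k \<Longrightarrow> contract A x is = 0"
  shows "degenerate_tensor (Suc (Suc k)) A"
  unfolding degenerate_tensor_def
proof (intro exI conjI allI impI)
  show "(\<lambda>_::nat. x) j \<noteq> 0" for j using assms(2) by simp
  fix j w assume "j < Suc (Suc k)"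
  show "multilinear_map (Suc (Suc k)) A ((\<lambda>_. x)(j := w)) = 0"
  proof (cases "j = 0")
    case True
    have "contract (contract A w) x is = 0" if "length is = k" for "is"
      using that by (subst contract_commute[OF sym]) (simp add: contract_def[of "contract A x"] 0)
    then show ?thesis
      using True by (simp add: multilinear_map_Suc multilinear_map_def[of k])
  next
    case False
    have "multilinear_map (Suc k) (contract A x) u = 0" for u
      by (simp add: multilinear_map_def 0)
    then show ?thesis
      using False by (simp add: multilinear_map_Suc[of "Suc k"])
  qed
qed

section \<open>Finiteness of the rank one locus\<close>

lemma multilinear_map_cong:
  "(\<And>is. length is = m \<Longrightarrow> A is = B is) \<Longrightarrow> multilinear_map m A v = multilinear_map m B v"
  by (simp add: multilinear_map_def)

lemma span_singleton_eq:
  fixes u v :: "complex ^ 'n::finite"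
  assumes "u \<in> vec.span {v}" "u \<noteq> 0"
  shows "vec.span {u} = vec.span {v}"
proof -
  obtain a where a: "u = a *s v" using assms(1) by (auto simp: vec.span_singleton)
  then have "v = inverse a *s u" using assms(2) by (auto simp: vector_smult_assoc)
  then have "v \<in> vec.span {u}" by (auto simp: vec.span_singleton)
  then show ?thesis using assms(1) by (auto intro!: vec.span_eq[THEN iffD2])
qed

theorem theorem3p5:
  fixes F :: "('n::finite, complex) mpoly" and n b :: nat
  assumes "CARD('n) = b + 1"
    and "n \<ge> 3"
    and "is_form n F"
  shows "(honest n F \<longrightarrow>
            finite (W n F \<inter> nonvanishing F) \<and> card (W n F \<inter> nonvanishing F) \<le> b + 1) \<and>
         (nondegenerate n F \<longrightarrow> finite (W n F))"
proof -
  obtain k where "n = 3 + k" using assms(2) by (auto simp: le_iff_add)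
  then have n: "n = Suc (Suc (Suc k))" "n - 1 = Suc (Suc k)" by simp_all
  \<comment> \<open>On lists of length \<open>n\<close> the entries are the constant derivatives of
    order \<open>n\<close>, so \<open>t\<close> is the polarization of \<open>F\<close> up to a
    factor.\<close>
  define t where "t = hess_at F 0"
  have sym: "symmetric_hypermatrix t" by (simp add: t_def symmetric_hess_at)
  have hess: "hess_at F x is = contract t x is" if "length is = Suc (Suc k)" for x "is"
    using hess_at_linear_expansion[of "is" F x] assms(3) that n by (simp add: t_def contract_def)
  have "\<exists>u. vec.span {u} = p \<and> u \<noteq> 0 \<and> (\<exists>c l. power_form (Suc (Suc k)) (contract t u) c l)"
    if pW: "p \<in> W n F" for p
  proof -
    obtain v u where p: "p = vec.span {v}" "u \<in> p" "u \<noteq> 0" "tensor_rank (n - 1) (hess_at F u) = 1"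
      using pW unfolding W_def proj_space_def by auto
    have "rank_one (Suc (Suc k)) (hess_at F u)"
      using p(4) n by (intro tensor_rank_1_imp_rank_one) auto
    then have "\<exists>c l. power_form (Suc (Suc k)) (hess_at F u) c l"
      by (intro rank_one_imp_power_form symmetric_hess_at)
    then show ?thesis
      using p span_singleton_eq[of u v] by (auto simp: power_form_def hess)
  qed
  then obtain g where g: "\<And>p. p \<in> W n F \<Longrightarrow> vec.span {g p} = p"
    and g0: "\<And>p. p \<in> W n F \<Longrightarrow> g p \<noteq> 0"
    and g_power: "\<And>p. p \<in> W n F \<Longrightarrow> \<exists>c l. power_form (Suc (Suc k)) (contract t (g p)) c l"
    by metis
  define B where "B = g ` W n F"
  have B0: "x \<noteq> 0" if "x \<in> B" for x using g0 that by (auto simp: B_def)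
  have "\<forall>x\<in>B. \<exists>c l. power_form (Suc (Suc k)) (contract t x) c l"
    using g_power by (auto simp: B_def)
  then obtain c l where power: "\<And>x. x \<in> B \<Longrightarrow> power_form (Suc (Suc k)) (contract t x) (c x) (l x)"
    by metis
  \<comment> \<open>\<open>B\<close> has one representative per point, so proportional members
    coincide.\<close>
  have B_eq: "x = y" if xy: "x \<in> B" "y \<in> B" and "y = r *s x" for x y r
  proof -
    obtain p q where pq: "p \<in> W n F" "q \<in> W n F" "x = g p" "y = g q" using xy by (auto simp: B_def)
    have "vec.span {y} = vec.span {x}"
      using that B0[of y] by (intro span_singleton_eq) (auto simp: vec.span_singleton)
    then show ?thesis using g pq by metis
  qed

  have "finite (W n F \<inter> nonvanishing F) \<and> card (W n F \<inter> nonvanishing F) \<le> b + 1" if "honest n F"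
  proof -
    have inj: "x = 0" if "\<And>is. length is = Suc (Suc k) \<Longrightarrow> contract t x is = 0" for x
      using \<open>honest n F\<close> that by (auto simp: honest_def zero_tensor_def n hess)
    let ?S = "W n F \<inter> nonvanishing F"
    \<comment> \<open>If l_p(p) = 0, two contractions with a representative of \<open>p\<close> give
      0. By Euler's identity the derivatives of order \<open>n - 2\<close>, which are quadratic
      forms, vanish there, and hence so does \<open>F\<close>.\<close>
    have self: "pairing (l (g p)) (g p) \<noteq> 0" if p: "p \<in> ?S" for p
    proof
      assume *: "pairing (l (g p)) (g p) = 0"
      have gB: "g p \<in> B" using p by (auto simp: B_def)
      obtain w where w: "w \<in> p" "eval_at F w \<noteq> 0" "w \<noteq> 0" using p by (auto simp: nonvanishing_def)
      then obtain a where a: "w = a *s g p" using g[of p] p by (auto simp: vec.span_singleton)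
      then have "power_form (Suc (Suc k)) (contract t w) (a * c (g p)) (l (g p))"
        using power[OF gB] w(3) by (auto intro!: power_form_contract_scale)
      then have "contract (contract t w) w is = 0" if "length is = Suc k" for "is"
        using that * a by (simp add: contract_power_form pairing_scale)
      then have "hess_at F w is = 0" if "length is = Suc k" for "is"
        using hess_at_euler[of "is" 2 F w] that assms(3) n
        by (simp add: hess contract_def[of "contract t w"])
      then have "eval_at F w = 0"
        using assms(3) n by (intro eval_at_eq_0_if_hess_at_eq_0[of n F "Suc k"]) auto
      then show False using w(2) by simp
    qed
    have "pairing (l x) y = 0" if xy: "x \<in> B" "y \<in> B" "x \<noteq> y" for x y
    proof (rule ccontr)
      assume "pairing (l x) y \<noteq> 0"
      then obtain s where "l y = s *s l x"
        using proportional_if_pairing_nonzero[OF sym power power] xy by blast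
      then have "\<exists>r. y = r *s x"
        using power[of x] power[of y] xy inj
        by (intro proportional_if_power_forms_proportional[of "Suc (Suc k)" t x "c x" "l x" y "c y" s]) auto
      then show False using B_eq xy by blast
    qed
    then have "vec.independent (g ` ?S)"
      using self by (intro independent_if_dual_family[where f = l]) (auto simp: B_def)
    then have "finite ?S \<and> card ?S \<le> CARD('n)"
      using g by (intro card_le_if_independent_representatives) auto
    then show ?thesis using assms(1) by simp
  qed
  moreover have "finite (W n F)" if nondeg: "nondegenerate n F"
  proof -
    obtain v where v: "\<not> degenerate_tensor (Suc (Suc k)) (hess_at F v)"
      using nondeg by (auto simp: nondegenerate_def is_hyperdeterminant_def n)
    have "multilinear_map (Suc (Suc k)) (hess_at F v) u = multilinear_map (Suc (Suc k)) (contract t v) u" for u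
      by (intro multilinear_map_cong hess)
    then have "\<not> degenerate_tensor (Suc (Suc k)) (contract t v)"
      using v by (simp add: degenerate_tensor_def)
    \<comment> \<open>By symmetry the double contraction is that of \<open>contract t v\<close> with
      \<open>x\<close>; a nonzero \<open>x\<close> killing it would make \<open>contract t v\<close>
      degenerate.\<close>
    then have inj_v: "x = 0" if "\<And>is. length is = Suc k \<Longrightarrow> contract (contract t x) v is = 0" for x
      using that degenerate_tensor_if_contract_eq_0[of "contract t v" x k] symmetric_contract[OF sym]
      by (auto simp: contract_commute[OF sym, of x v])
    have inj: "x = 0" if "\<And>is. length is = Suc (Suc k) \<Longrightarrow> contract t x is = 0" for x
      using that by (intro inj_v) (simp add: contract_def[of "contract t x"])
    have pair: "pairing (l x) v \<noteq> 0" if x: "x \<in> B" for x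
    proof
      assume "pairing (l x) v = 0"
      then have "contract (contract t x) v is = 0" if "length is = Suc k" for "is"
        using contract_power_form[OF power[OF x] that] by simp
      then show False using inj_v B0[OF x] by blast
    qed
    \<comment> \<open>The eigenvalue is the ratio of t(x, y) = c l(y) l^(k+1) to t(x, v) = c l(v)
      l^(k+1).\<close>
    define h where "h = (\<lambda>x y. pairing (l x) y / pairing (l x) v)"
    have "vec.independent B"
    proof (rule independent_if_eigenvectors[where m = "Suc k" and v = v and t = t and h = h])
      show "0 \<notin> B" using B0 by blast
      show "x = 0" if "\<And>is. length is = Suc k \<Longrightarrow> contract (contract t x) v is = 0" for x
        using that by (rule inj_v)
      show "contract (contract t x) y is = h x y * contract (contract t x) v is"
        if "x \<in> B" "length is = Suc k" for x y "is"
        using contract_power_form[OF power[OF that(1)] that(2)] pair[OF that(1)] by (simp add: h_def)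
      show "inj_on h B"
      proof (rule inj_onI)
        fix x y assume xy: "x \<in> B" "y \<in> B" "h x = h y"
        \<comment> \<open>Evaluating the eigenvalue functions on basis vectors recovers the
          coordinates of the linear forms up to a common factor.\<close>
        have "l y $ i = pairing (l y) v / pairing (l x) v * l x $ i" for i
          using fun_cong[OF xy(3), of "axis i 1"] pair xy(1,2) by (simp add: h_def pairing_axis field_simps)
        then have "l y = (pairing (l y) v / pairing (l x) v) *s l x" by (simp add: vec_eq_iff)
        then have "\<exists>r. y = r *s x"
          using power[of x] power[of y] xy inj
          by (intro proportional_if_power_forms_proportional[of "Suc (Suc k)" t x "c x" "l x" y "c y"
                "pairing (l y) v / pairing (l x) v"]) auto
        then show "x = y" using B_eq xy by blast
      qed
    qed
    then show ?thesis
      using g card_le_if_independent_representatives[of "W n F" g] by (auto simp: B_def)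
  qed
  ultimately show ?thesis by blast
qed

end
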